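(* The noncommutative variational Schouten bracket is shifted-graded skew-symmetric: if $\boldsymbol\xi$ is a noncommutative variational $k$-vector and $\boldsymbol\eta$ is a noncommutative variational $\ell$-vector ($k,\ell\ge 0$), then $$[\![\boldsymbol\xi,\boldsymbol\eta]\!]=-(-1)^{(k-1)(\ell-1)}[\![\boldsymbol\eta,\boldsymbol\xi]\!].$$
   Context: Setting. $M^n$ is a smooth oriented $n$-manifold with local coordinates $\boldsymbol{x}=(x^1,\dots,x^n)$ and $\mathrm{d}\boldsymbol{x}=\mathrm{d}x^1\wedge\dots\wedge\mathrm{d}x^n$. There are even letters $a^j_\sigma$ and odd letters $b_{j,\tau}$ ($1\le j\le m$; $\sigma,\tau$ multi-indices; $a^j_\emptyset=a^j$, $b_{j,\emptyset}=b_j$). Differential functions are finite sums of words (noncommutative monomials) in these letters with coefficients smooth in $\boldsymbol{x}$. The total derivatives are the derivations $\frac{\mathrm d}{\mathrm dx^i}$ acting on coefficients by $\partial/\partial x^i$ and on letters by $a^j_\sigma\mapsto a^j_{\sigma+1_i}$, $b_{j,\tau}\mapsto b_{j,\tau+1_i}$. Multivectors. A noncommutative variational $k$-vector is the class of a density $f\,\mathrm d\boldsymbol x$, with $f$ homogeneous of degree $k$ in the odd letters, modulo the image of the horizontal differential $\bar{\mathrm d}=\sum_i\mathrm dx^i\cdot\frac{\mathrm d}{\mathrm dx^i}$ (i.e. modulo sums of total derivatives) and modulo cyclic permutations of the letters in each word. Cyclic permutations obey the sign rule that carrying an odd letter past $r$ other odd letters gives $(-1)^r$ (even letters move without sign).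 Variational derivatives. Vary one letter at a time, summing over all occurrences in the density; integrate by parts so that no derivatives fall on $\delta a^j$ (even) or $\delta b_j$ (odd). Then rotate each cyclic word, with the sign rule, so that the variation is the rightmost letter, and delete it: this gives $\overrightarrow{\delta}\boldsymbol\xi/\delta a^j$, $\overrightarrow\delta\boldsymbol\xi/\delta b_j$. Rotating so that the variation is leftmost and deleting it gives $\overleftarrow\delta\boldsymbol\eta/\delta a^j$, $\overleftarrow\delta\boldsymbol\eta/\delta b_j$. Schouten bracket. $[\![\boldsymbol\xi,\boldsymbol\eta]\!]$ is the class of $\sum_j\Bigl(\frac{\overrightarrow\delta\boldsymbol\xi}{\delta a^j}\cdot\frac{\overleftarrow\delta\boldsymbol\eta}{\delta b_j}-\frac{\overrightarrow\delta\boldsymbol\xi}{\delta b_j}\cdot\frac{\overleftarrow\delta\boldsymbol\eta}{\delta a^j}\Bigr)\mathrm d\boldsymbol x$, where $\cdot$ is concatenation of words. *)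

theory Defs
  imports "HOL-Analysis.Analysis" "HOL-Library.Function_Algebras" "HOL-Library.Poly_Mapping"
begin

section \<open>Smooth coefficients\<close>

text \<open>The coordinate domain of \<open>x\<^sup>1, \<dots>, x\<^sup>n\<close> is an open set \<open>U\<close> in \<open>real ^ 'n\<close>; the linear order
  on \<open>'n\<close> numbers the coordinates. A function on \<open>U\<close> is represented by its extension by zero
  to all of \<open>real ^ 'n\<close>, so that equality on \<open>U\<close> is equality.\<close>

definition partial :: "(real ^ 'n) set \<Rightarrow> 'n \<Rightarrow> (real ^ 'n \<Rightarrow> real) \<Rightarrow> (real ^ 'n \<Rightarrow> real)" where
  "partial U i c = (\<lambda>x. if x \<in> U then frechet_derivative c (at x) (axis i 1) else 0)"

definition smooth :: "(real ^ 'n) set \<Rightarrow> (real ^ 'n \<Rightarrow> real) \<Rightarrow> bool" where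
  "smooth U c \<longleftrightarrow> (\<forall>x. x \<notin> U \<longrightarrow> c x = 0) \<and>
     (\<forall>is. \<forall>x\<in>U. foldr (partial U) is c differentiable (at x))"


section \<open>Words and differential functions\<close>

datatype 'm gen = Even_Gen 'm | Odd_Gen 'm

text \<open>The letter \<open>(Even_Gen j, \<sigma>)\<close> is \<open>a\<close> with upper index \<open>j\<close> and lower index \<open>\<sigma>\<close>; the letter
  \<open>(Odd_Gen j, \<tau>)\<close> is \<open>b\<close> with lower indices \<open>j, \<tau>\<close>. A multi-index counts, for every coordinate,
  the derivatives in that direction.\<close>

type_synonym ('m, 'n) letter = "'m gen \<times> ('n \<Rightarrow> nat)"

fun is_odd :: "('m, 'n) letter \<Rightarrow> bool" where
  "is_odd (Even_Gen j, \<sigma>) = False"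
| "is_odd (Odd_Gen j, \<sigma>) = True"

definition odd_deg :: "('m, 'n) letter list \<Rightarrow> nat" where
  "odd_deg w = length (filter is_odd w)"

definition shift :: "'n \<Rightarrow> ('m, 'n) letter \<Rightarrow> ('m, 'n) letter" where
  "shift i = (\<lambda>(g, \<sigma>). (g, \<sigma>(i := Suc (\<sigma> i))))"

text \<open>Words form a monoid under concatenation. This makes the product of finitely supported
  functions on words the concatenation product of noncommutative differential functions.\<close>

instantiation list :: (type) monoid_add
begin

definition zero_list :: "'a list" where "zero_list = []"
definition plus_list :: "'a list \<Rightarrow> 'a list \<Rightarrow> 'a list" where "plus_list u v = u @ v"

instance
  by standard (simp_all add: zero_list_def plus_list_def)

end

type_synonym ('m, 'n) dfun = "('m, 'n) letter list \<Rightarrow>\<^sub>0 (real ^ 'n \<Rightarrow> real)"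

definition smul :: "real \<Rightarrow> ('m, 'n) dfun \<Rightarrow> ('m, 'n) dfun" where
  "smul r = Poly_Mapping.map (\<lambda>c x. r * c x)"

definition dfuns :: "(real ^ 'n) set \<Rightarrow> ('m, 'n) dfun set" where
  "dfuns U = {F. \<forall>w. smooth U (Poly_Mapping.lookup F w)}"

text \<open>Degrees are integers because the bracket of two \<open>0\<close>-vectors has degree \<open>-1\<close>
  (where \<open>0\<close> is the only density).\<close>

definition homogeneous :: "int \<Rightarrow> ('m, 'n) dfun \<Rightarrow> bool" where
  "homogeneous d F \<longleftrightarrow> (\<forall>w\<in>Poly_Mapping.keys F. int (odd_deg w) = d)"

definition total_deriv :: "(real ^ 'n) set \<Rightarrow> 'n \<Rightarrow> ('m, 'n) dfun \<Rightarrow> ('m, 'n) dfun" where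
  "total_deriv U i F = (\<Sum>w\<in>Poly_Mapping.keys F.
     Poly_Mapping.single w (partial U i (Poly_Mapping.lookup F w)) +
     (\<Sum>p<length w. Poly_Mapping.single (w[p := shift i (w ! p)]) (Poly_Mapping.lookup F w)))"

text \<open>The operator \<open>(- d/dx)\<^sup>\<sigma>\<close>.\<close>

definition adj_deriv ::
    "(real ^ 'n::{finite,linorder}) set \<Rightarrow> ('n \<Rightarrow> nat) \<Rightarrow> ('m, 'n) dfun \<Rightarrow> ('m, 'n) dfun" where
  "adj_deriv U \<sigma> = foldr (\<lambda>i G. - total_deriv U i G)
     (concat (map (\<lambda>i. replicate (\<sigma> i) i) (sorted_list_of_set UNIV)))"


section \<open>Noncommutative variational multivectors\<close>

text \<open>A density \<open>f dx\<close> is represented by \<open>f\<close>. The relations are spanned by the total derivatives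
  and by the cyclic permutations carrying the first letter of a word past all the others.
  Both families of generators are closed under real multiples, hence so is their span.\<close>

inductive_set relations :: "(real ^ 'n) set \<Rightarrow> ('m, 'n) dfun set" for U where
  zero: "0 \<in> relations U"
| add: "F \<in> relations U \<Longrightarrow> G \<in> relations U \<Longrightarrow> F + G \<in> relations U"
| total: "H \<in> dfuns U \<Longrightarrow> total_deriv U i H \<in> relations U"
| cyclic: "smooth U c \<Longrightarrow>
    Poly_Mapping.single (y # w) c -
    smul ((-1) ^ (odd_deg [y] * odd_deg w)) (Poly_Mapping.single (w @ [y]) c) \<in> relations U"

definition vclass :: "(real ^ 'n) set \<Rightarrow> int \<Rightarrow> ('m, 'n) dfun \<Rightarrow> ('m, 'n) dfun set" where
  "vclass U d F = {G \<in> dfuns U. homogeneous d G \<and> G - F \<in> relations U}"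

definition multivectors :: "(real ^ 'n) set \<Rightarrow> int \<Rightarrow> ('m, 'n) dfun set set" where
  "multivectors U d = vclass U d ` {F \<in> dfuns U. homogeneous d F}"

definition class_scale ::
    "(real ^ 'n) set \<Rightarrow> int \<Rightarrow> real \<Rightarrow> ('m, 'n) dfun set \<Rightarrow> ('m, 'n) dfun set" where
  "class_scale U d r \<xi> = (\<Union>F\<in>\<xi>. vclass U d (smul r F))"


section \<open>Variational derivatives\<close>

text \<open>Let \<open>f u y v\<close> be a term of the density with coefficient \<open>f\<close> and let the letter
  \<open>y = (g, \<sigma>)\<close> be varied. Carrying the odd letters of \<open>v\<close> to the far left, each past those of \<open>u y\<close>,
  rewrites the cyclic word as \<open>f v u y\<close> up to sign, with the variation in rightmost position;
  integration by parts then throws \<open>(- d/dx)\<^sup>\<sigma>\<close> onto \<open>f v u\<close>. (Total derivatives do not change the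
  parity of letters, so integrating by parts before rotating gives the same.) In the left
  derivative it is \<open>u\<close> that is carried, to the far right. The argument \<open>g\<close> selects
  \<open>a\<close> or \<open>b\<close> and its index.\<close>

definition rvar :: "(real ^ 'n::{finite,linorder}) set \<Rightarrow> 'm gen \<Rightarrow> ('m, 'n) dfun \<Rightarrow> ('m, 'n) dfun"
  where
  "rvar U g F = (\<Sum>w\<in>Poly_Mapping.keys F. \<Sum>p | p < length w \<and> fst (w ! p) = g.
     let u = take p w; y = w ! p; v = drop (Suc p) w in
     adj_deriv U (snd y) (smul ((-1) ^ (odd_deg v * odd_deg (u @ [y])))
       (Poly_Mapping.single (v @ u) (Poly_Mapping.lookup F w))))"

definition lvar :: "(real ^ 'n::{finite,linorder}) set \<Rightarrow> 'm gen \<Rightarrow> ('m, 'n) dfun \<Rightarrow> ('m, 'n) dfun"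
  where
  "lvar U g F = (\<Sum>w\<in>Poly_Mapping.keys F. \<Sum>p | p < length w \<and> fst (w ! p) = g.
     let u = take p w; y = w ! p; v = drop (Suc p) w in
     adj_deriv U (snd y) (smul ((-1) ^ (odd_deg u * odd_deg (y # v)))
       (Poly_Mapping.single (v @ u) (Poly_Mapping.lookup F w))))"


section \<open>The Schouten bracket\<close>

definition schouten_density ::
    "(real ^ 'n::{finite,linorder}) set \<Rightarrow> ('m::finite, 'n) dfun \<Rightarrow> ('m, 'n) dfun \<Rightarrow> ('m, 'n) dfun"
  where
  "schouten_density U F G = (\<Sum>j\<in>UNIV.
     rvar U (Even_Gen j) F * lvar U (Odd_Gen j) G - rvar U (Odd_Gen j) F * lvar U (Even_Gen j) G)"

text \<open>The bracket of a \<open>k\<close>-vector and an \<open>l\<close>-vector. As for any operation lifted to a quotient,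
  the union runs over all representatives; since the variational derivatives annihilate total
  derivatives and are invariant under cyclic permutations, the classes united here are all equal.\<close>

definition schouten ::
    "(real ^ 'n::{finite,linorder}) set \<Rightarrow> int \<Rightarrow> int \<Rightarrow>
     ('m::finite, 'n) dfun set \<Rightarrow> ('m, 'n) dfun set \<Rightarrow> ('m, 'n) dfun set" where
  "schouten U k l \<xi> \<eta> = (\<Union>F\<in>\<xi>. \<Union>G\<in>\<eta>. vclass U (k + l - 1) (schouten_density U F G))"

end

theory Submission
  imports Defs
begin

text \<open>Rotating the remaining word carries \<open>v\<close> past \<open>u y\<close> in the right derivative and \<open>u\<close> past \<open>y v\<close>
  in the left one, so on a density of degree \<open>k\<close> the two agree for an even letter and differ by
  \<open>(-1)\<^bsup>k-1\<^esup>\<close> for an odd one. Rewriting the bracket with right derivatives only, its two halves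
  are exchanged by the graded commutativity \<open>P Q \<sim> (-1)\<^bsup>pq\<^esup> Q P\<close> of cyclic words. No integration by
  parts is needed.\<close>

section \<open>Smooth functions\<close>

lemma smooth_zero_outside: "smooth U c \<Longrightarrow> x \<notin> U \<Longrightarrow> c x = 0"
  by (simp add: smooth_def)

lemma smooth_differentiable: "smooth U c \<Longrightarrow> x \<in> U \<Longrightarrow> c differentiable (at x)"
  unfolding smooth_def by (metis foldr.simps(1) id_apply)

lemma smooth_partial:
  assumes "smooth U c"
  shows "smooth U (partial U i c)"
  unfolding smooth_def
proof (intro conjI allI ballI impI)
  show "partial U i c x = 0" if "x \<notin> U" for x
    using that by (simp add: partial_def)
  show "foldr (partial U) is (partial U i c) differentiable (at x)" if "x \<in> U" for "is" x
  proof -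
    \<comment> \<open>\<open>foldr\<close> applies the last list entry first, so a derivative taken
      before those in \<open>is\<close> is appended at the end of the list.\<close>
    have "foldr (partial U) (is @ [i]) c differentiable (at x)"
      using assms that unfolding smooth_def by blast
    then show ?thesis by simp
  qed
qed

text \<open>If a family of differentiable functions vanishing off \<open>U\<close> is closed under
  partial derivatives, then all iterated derivatives stay in it. Closure properties of smooth
  functions thus follow from one derivative at a time.\<close>

lemma smooth_coinduct:
  assumes "c \<in> A"
    and "\<And>c x. c \<in> A \<Longrightarrow> x \<notin> U \<Longrightarrow> c x = 0"
    and "\<And>c x. c \<in> A \<Longrightarrow> x \<in> U \<Longrightarrow> c differentiable (at x)"
    and "\<And>c i. c \<in> A \<Longrightarrow> partial U i c \<in> A"
  shows "smooth U c"
proof -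
  have "foldr (partial U) is c \<in> A" for "is"
    by (induction "is") (auto simp: assms)
  then show ?thesis
    using assms(1-3) by (auto simp: smooth_def)
qed

section \<open>Sum, sign and product rules for partial derivatives\<close>

lemma partial_zero: "partial U i 0 = 0"
  by (auto simp: partial_def fun_eq_iff zero_fun_def)

text \<open>Only differentiability on \<open>U\<close> is assumed, so that the rule applies to sums
  of products before these are known to be smooth.\<close>

lemma partial_add:
  assumes "\<And>x. x \<in> U \<Longrightarrow> c differentiable (at x)" "\<And>x. x \<in> U \<Longrightarrow> d differentiable (at x)"
  shows "partial U i (c + d) = partial U i c + partial U i d"
proof
  fix x
  have "frechet_derivative (\<lambda>x. c x + d x) (at x) =
      (\<lambda>h. frechet_derivative c (at x) h + frechet_derivative d (at x) h)" if "x \<in> U"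
    using assms that
    by (intro frechet_derivative_at[symmetric] has_derivative_add)
      (auto simp: frechet_derivative_works[symmetric])
  then show "partial U i (c + d) x = (partial U i c + partial U i d) x"
    by (simp add: partial_def plus_fun_def)
qed

lemma partial_uminus:
  assumes "smooth U c"
  shows "partial U i (- c) = - partial U i c"
proof
  fix x
  have "frechet_derivative (\<lambda>x. - c x) (at x) = (\<lambda>h. - frechet_derivative c (at x) h)" if "x \<in> U"
    using assms that
    by (intro frechet_derivative_at[symmetric] has_derivative_minus)
      (auto simp: frechet_derivative_works[symmetric] smooth_differentiable)
  then show "partial U i (- c) x = (- partial U i c) x"
    by (simp add: partial_def fun_Compl_def)
qed

lemma partial_mult:
  assumes "smooth U c" "smooth U d"
  shows "partial U i (c * d) = c * partial U i d + partial U i c * d"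
proof
  fix x
  have "frechet_derivative (\<lambda>x. c x * d x) (at x) =
      (\<lambda>h. c x * frechet_derivative d (at x) h + frechet_derivative c (at x) h * d x)" if "x \<in> U"
    using assms that
    by (intro frechet_derivative_at[symmetric] has_derivative_mult)
      (auto simp: frechet_derivative_works[symmetric] smooth_differentiable)
  then show "partial U i (c * d) x = (c * partial U i d + partial U i c * d) x"
    by (simp add: partial_def plus_fun_def times_fun_def)
qed

section \<open>Closure of the smooth functions under ring operations\<close>

lemma smooth_zero: "smooth U 0"
  by (rule smooth_coinduct[of _ "{0}"]) (simp_all add: partial_zero, simp add: zero_fun_def)

lemma smooth_add:
  assumes "smooth U c" "smooth U d"
  shows "smooth U (c + d)"
proof (rule smooth_coinduct[of _ "{c + d |c d. smooth U c \<and> smooth U d}"])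
  show "partial U i e \<in> {c + d |c d. smooth U c \<and> smooth U d}"
    if "e \<in> {c + d |c d. smooth U c \<and> smooth U d}" for e i
    using that by (force simp: partial_add smooth_differentiable intro: smooth_partial)
qed (use assms in \<open>auto simp: smooth_zero_outside smooth_differentiable plus_fun_def\<close>)

lemma smooth_uminus:
  assumes "smooth U c"
  shows "smooth U (- c)"
proof (rule smooth_coinduct[of _ "{- c |c. smooth U c}"])
  show "partial U i e \<in> {- c |c. smooth U c}" if "e \<in> {- c |c. smooth U c}" for e i
    using that by (force simp: partial_uminus intro: smooth_partial)
qed (use assms in \<open>auto simp: smooth_zero_outside smooth_differentiable fun_Compl_def\<close>)

text \<open>The Leibniz rule turns one product into a sum of two, so products alone are not an
  invariant family for the coinduction; their finite sums are.\<close>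

inductive_set sums_of_products :: "(real ^ 'n) set \<Rightarrow> (real ^ 'n \<Rightarrow> real) set" for U where
  prod: "smooth U c \<Longrightarrow> smooth U d \<Longrightarrow> c * d \<in> sums_of_products U"
| add: "c \<in> sums_of_products U \<Longrightarrow> d \<in> sums_of_products U \<Longrightarrow> c + d \<in> sums_of_products U"

lemma sums_of_products_differentiable:
  "c \<in> sums_of_products U \<Longrightarrow> x \<in> U \<Longrightarrow> c differentiable (at x)"
  by (induction rule: sums_of_products.induct)
    (simp_all add: plus_fun_def times_fun_def smooth_differentiable)

lemma smooth_mult:
  assumes "smooth U c" "smooth U d"
  shows "smooth U (c * d)"
proof (rule smooth_coinduct[of _ "sums_of_products U"])
  show "c * d \<in> sums_of_products U"
    using assms by (rule sums_of_products.prod)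
next
  fix c and x :: "real ^ 'a"
  assume "c \<in> sums_of_products U" "x \<notin> U"
  then show "c x = 0"
    by (induction rule: sums_of_products.induct) (simp_all add: smooth_zero_outside)
next
  fix c i
  assume "c \<in> sums_of_products U"
  then show "partial U i c \<in> sums_of_products U"
  proof (induction rule: sums_of_products.induct)
    case (prod c d)
    then show ?case
      unfolding partial_mult[OF prod] by (intro sums_of_products.intros smooth_partial)
  next
    case (add c d)
    then show ?case
      by (subst partial_add) (auto intro: sums_of_products_differentiable sums_of_products.add)
  qed
qed (rule sums_of_products_differentiable)


section \<open>Differential functions\<close>

lemma dfuns_zero: "0 \<in> dfuns U"
  by (simp add: dfuns_def smooth_zero)

lemma dfuns_add: "F \<in> dfuns U \<Longrightarrow> G \<in> dfuns U \<Longrightarrow> F + G \<in> dfuns U"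
  by (simp add: dfuns_def lookup_add smooth_add)

lemma dfuns_uminus: "F \<in> dfuns U \<Longrightarrow> - F \<in> dfuns U"
  by (simp add: dfuns_def smooth_uminus)

lemma dfuns_sum: "(\<And>x. x \<in> A \<Longrightarrow> f x \<in> dfuns U) \<Longrightarrow> sum f A \<in> dfuns U"
  by (induction A rule: infinite_finite_induct) (auto simp: dfuns_zero dfuns_add)

lemma dfuns_single: "smooth U c \<Longrightarrow> Poly_Mapping.single w c \<in> dfuns U"
  by (simp add: dfuns_def lookup_single when_def smooth_zero)

lemma dfuns_smooth: "F \<in> dfuns U \<Longrightarrow> smooth U (Poly_Mapping.lookup F w)"
  by (simp add: dfuns_def)

section \<open>Homogeneity and the number of odd letters\<close>

lemma homogeneous_zero: "homogeneous d 0"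
  by (simp add: homogeneous_def)

lemma homogeneous_add: "homogeneous d F \<Longrightarrow> homogeneous d G \<Longrightarrow> homogeneous d (F + G)"
  using Poly_Mapping.keys_add[of F G] by (auto simp: homogeneous_def)

lemma homogeneous_uminus: "homogeneous d F \<Longrightarrow> homogeneous d (- F)"
  by (simp add: homogeneous_def)

lemma homogeneous_sum: "(\<And>x. x \<in> A \<Longrightarrow> homogeneous d (f x)) \<Longrightarrow> homogeneous d (sum f A)"
  by (induction A rule: infinite_finite_induct) (auto simp: homogeneous_zero homogeneous_add)

lemma homogeneous_single: "int (odd_deg w) = d \<Longrightarrow> homogeneous d (Poly_Mapping.single w c)"
  by (simp add: homogeneous_def)

lemma odd_deg_append [simp]: "odd_deg (u @ v) = odd_deg u + odd_deg v"
  by (simp add: odd_deg_def)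

lemma odd_deg_Cons: "odd_deg (y # w) = odd_deg [y] + odd_deg w"
  by (simp add: odd_deg_def)

lemma odd_deg_shift [simp]: "odd_deg [shift i y] = odd_deg [y]"
  by (cases y; cases "fst y") (auto simp: odd_deg_def shift_def)

lemma odd_deg_update_shift: "p < length w \<Longrightarrow> odd_deg (w[p := shift i (w ! p)]) = odd_deg w"
  by (subst (3) id_take_nth_drop[of p w])
    (simp_all add: upd_conv_take_nth_drop odd_deg_Cons[of _ "drop (Suc p) w"])

text \<open>Every scalar in the variational derivatives and in the cyclic relations is a sign; as a
  conditional negation it can be handled by additive group reasoning and parity.\<close>

lemma smul_sign: "smul ((-1) ^ n) F = (if even n then F else - F)"
proof (rule poly_mapping_eqI)
  show "Poly_Mapping.lookup (smul ((-1) ^ n) F) w =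
      Poly_Mapping.lookup (if even n then F else - F) w" for w
    by (auto simp: smul_def map.rep_eq when_def fun_eq_iff zero_fun_def fun_Compl_def)
qed

lemma smul_one: "smul 1 F = F" and smul_minus_one: "smul (- 1) F = - F"
  using smul_sign[of 0 F] smul_sign[of 1 F] by simp_all

text \<open>The exponent is an integer because \<open>(k - 1) * (l - 1)\<close> is negative when one
  degree is 0 and the other exceeds 1.\<close>

lemma smul_neg_powi_sign: "smul (- ((-1) powi n)) F = (if even n then - F else F)"
  by (simp add: power_int_minus_left smul_one smul_minus_one)

section \<open>Total derivatives and integration by parts\<close>

lemma total_deriv_dfuns: "F \<in> dfuns U \<Longrightarrow> total_deriv U i F \<in> dfuns U"
  unfolding total_deriv_def
  by (intro dfuns_sum dfuns_add dfuns_single smooth_partial dfuns_smooth)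

lemma total_deriv_homogeneous: "homogeneous d F \<Longrightarrow> homogeneous d (total_deriv U i F)"
  unfolding total_deriv_def
  by (intro homogeneous_sum homogeneous_add homogeneous_single)
    (auto simp: homogeneous_def odd_deg_update_shift)

text \<open>Negation preserves the support, so both sums run over the same words and compare term by
  term.\<close>

lemma total_deriv_uminus:
  "F \<in> dfuns U \<Longrightarrow> total_deriv U i (- F) = - total_deriv U i F"
  unfolding total_deriv_def
  by (simp add: dfuns_smooth partial_uminus single_uminus sum_negf[symmetric]
      del: sum_negf)

lemma foldr_total_deriv_dfuns:
  "F \<in> dfuns U \<Longrightarrow> foldr (\<lambda>i G. - total_deriv U i G) is F \<in> dfuns U"
  by (induction "is") (auto intro: dfuns_uminus total_deriv_dfuns)

lemma adj_deriv_dfuns: "F \<in> dfuns U \<Longrightarrow> adj_deriv U \<sigma> F \<in> dfuns U"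
  unfolding adj_deriv_def by (rule foldr_total_deriv_dfuns)

lemma adj_deriv_homogeneous:
  assumes "homogeneous d F"
  shows "homogeneous d (adj_deriv U \<sigma> F)"
proof -
  have "homogeneous d (foldr (\<lambda>i G. - total_deriv U i G) is F)" for "is"
    using assms by (induction "is") (auto intro: homogeneous_uminus total_deriv_homogeneous)
  then show ?thesis
    by (simp add: adj_deriv_def)
qed

lemma adj_deriv_uminus:
  assumes "F \<in> dfuns U"
  shows "adj_deriv U \<sigma> (- F) = - adj_deriv U \<sigma> F"
proof -
  have "foldr (\<lambda>i G. - total_deriv U i G) is (- F) =
      - foldr (\<lambda>i G. - total_deriv U i G) is F" for "is"
    using assms
    by (induction "is") (auto simp: total_deriv_uminus foldr_total_deriv_dfuns dfuns_uminus)
  then show ?thesis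
    by (simp add: adj_deriv_def)
qed


section \<open>Variational derivatives\<close>

lemma rvar_dfuns: "F \<in> dfuns U \<Longrightarrow> rvar U g F \<in> dfuns U"
  unfolding rvar_def Let_def smul_sign
  by (intro dfuns_sum adj_deriv_dfuns) (auto intro: dfuns_single dfuns_uminus dfuns_smooth)

lemma odd_deg_split:
  "p < length w \<Longrightarrow> odd_deg w = odd_deg (take p w) + odd_deg [w ! p] + odd_deg (drop (Suc p) w)"
  by (subst (1) id_take_nth_drop[of p w]) (simp_all add: odd_deg_Cons[of _ "drop (Suc p) w"])

text \<open>Parity depends on the generator alone. Hence \<open>odd_deg [(g, \<sigma>)]\<close>,
  with \<open>\<sigma>\<close> arbitrary, serves below as the parity of \<open>g\<close>.\<close>

lemma odd_deg_gen: "odd_deg [y] = odd_deg [(fst y, \<sigma>)]"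
  by (cases y; cases "fst y") (auto simp: odd_deg_def)

text \<open>Deleting the varied letter lowers the degree by its parity, and the derivatives thrown
  onto the remaining word preserve the degree.\<close>

lemma rvar_homogeneous:
  assumes "homogeneous k F"
  shows "homogeneous (k - int (odd_deg [(g, \<sigma>)])) (rvar U g F)"
  unfolding rvar_def Let_def smul_sign
proof (intro homogeneous_sum adj_deriv_homogeneous)
  fix w p
  assume "w \<in> Poly_Mapping.keys F" and "p \<in> {p. p < length w \<and> fst (w ! p) = g}"
  then have "int (odd_deg (drop (Suc p) w @ take p w)) = k - int (odd_deg [(g, \<sigma>)])"
    using assms odd_deg_split[of p w] odd_deg_gen[of "w ! p" \<sigma>] by (auto simp: homogeneous_def)
  from homogeneous_single[OF this]
  show "homogeneous (k - int (odd_deg [(g, \<sigma>)]))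
      (if even (odd_deg (drop (Suc p) w) * odd_deg (take p w @ [w ! p]))
       then Poly_Mapping.single (drop (Suc p) w @ take p w) (Poly_Mapping.lookup F w)
       else - Poly_Mapping.single (drop (Suc p) w @ take p w) (Poly_Mapping.lookup F w))"
    by (simp add: homogeneous_uminus)
qed

text \<open>Both derivatives leave the same word \<open>v @ u\<close>. If \<open>u\<close>,
  \<open>y\<close>, \<open>v\<close> have odd degrees a, e, b, the sign exponents are a(e+b) and
  b(a+e). Modulo 2 they differ by e(a+b) = e(k-e), which is e(k-1) because e is 0 or 1.\<close>

lemma lvar_eq_rvar:
  assumes "F \<in> dfuns U" "homogeneous k F"
  shows "lvar U g F = (if even (int (odd_deg [(g, \<sigma>)]) * (k - 1)) then rvar U g F else - rvar U g F)"
proof -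
  let ?e = "even (int (odd_deg [(g, \<sigma>)]) * (k - 1))"
  let ?r = "\<lambda>w p. adj_deriv U (snd (w ! p))
      (smul ((-1) ^ (odd_deg (drop (Suc p) w) * odd_deg (take p w @ [w ! p])))
        (Poly_Mapping.single (drop (Suc p) w @ take p w) (Poly_Mapping.lookup F w)))"
  have "adj_deriv U (snd (w ! p))
      (smul ((-1) ^ (odd_deg (take p w) * odd_deg (w ! p # drop (Suc p) w)))
        (Poly_Mapping.single (drop (Suc p) w @ take p w) (Poly_Mapping.lookup F w))) =
      (if ?e then ?r w p else - ?r w p)"
    if "w \<in> Poly_Mapping.keys F" "p < length w" "fst (w ! p) = g" for w p
  proof -
    let ?S = "Poly_Mapping.single (drop (Suc p) w @ take p w) (Poly_Mapping.lookup F w)"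
    \<comment> \<open>The sign can be pulled out of the integration by parts, which reduces the
      claim to comparing parities.\<close>
    have "adj_deriv U (snd (w ! p)) (- ?S) = - adj_deriv U (snd (w ! p)) ?S"
      using assms(1) by (intro adj_deriv_uminus dfuns_single dfuns_smooth)
    moreover have "k = int (odd_deg (take p w) + odd_deg [(g, \<sigma>)] + odd_deg (drop (Suc p) w))"
      using assms(2) that odd_deg_split[of p w] odd_deg_gen[of "w ! p" \<sigma>]
      by (auto simp: homogeneous_def)
    ultimately show ?thesis
      using that odd_deg_gen[of "w ! p" \<sigma>]
      by (auto simp: smul_sign odd_deg_Cons[of _ "drop (Suc p) w"])
  qed
  then have "lvar U g F = (\<Sum>w\<in>Poly_Mapping.keys F. \<Sum>p | p < length w \<and> fst (w ! p) = g.
      if ?e then ?r w p else - ?r w p)"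
    unfolding lvar_def Let_def by (intro sum.cong) auto
  also have "\<dots> = (if ?e then rvar U g F else - rvar U g F)"
    unfolding rvar_def Let_def by (cases ?e) (simp_all add: sum_negf)
  finally show ?thesis .
qed


section \<open>Cyclic words\<close>

text \<open>Both families of generators are stable under negation: replace \<open>H\<close> by
  \<open>- H\<close>, or the coefficient \<open>c\<close> by \<open>- c\<close>. So the relations
  form an additive group.\<close>

lemma relations_uminus: "F \<in> relations U \<Longrightarrow> - F \<in> relations U"
proof (induction rule: relations.induct)
  case zero
  then show ?case by (simp add: relations.zero)
next
  case (add F G)
  then show ?case using relations.add[of "- F" U "- G"] by simp
next
  case (total H i)
  then show ?case
    using relations.total[of "- H" U i] by (simp add: total_deriv_uminus dfuns_uminus)
next
  case (cyclic c y w)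
  then show ?case
    using relations.cyclic[of U "- c" y w]
    by (auto simp: smooth_uminus smul_sign single_uminus minus_diff_commute split: if_splits)
qed

lemma relations_diff: "F \<in> relations U \<Longrightarrow> G \<in> relations U \<Longrightarrow> F - G \<in> relations U"
  using relations.add[of F U "- G"] relations_uminus[of G U] by simp

lemma relations_sum: "(\<And>x. x \<in> A \<Longrightarrow> f x \<in> relations U) \<Longrightarrow> sum f A \<in> relations U"
  by (induction A rule: infinite_finite_induct) (auto simp: relations.zero relations.add)

text \<open>The first letter \<open>y\<close> is carried to the far right, then the rest
  \<open>u\<close> is carried past \<open>v @ [y]\<close>, which is why \<open>v\<close> varies in
  the induction. The product of the degrees of \<open>y\<close> and \<open>u\<close> enters the
  exponent twice and cancels modulo 2.\<close>

lemma relations_rotate: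
  assumes "smooth U c"
  shows "Poly_Mapping.single (u @ v) c -
    smul ((-1) ^ (odd_deg u * odd_deg v)) (Poly_Mapping.single (v @ u) c) \<in> relations U"
proof (induction u arbitrary: v)
  case Nil
  then show ?case by (simp add: smul_one odd_deg_def relations.zero)
next
  case (Cons y u)
  let ?m = "Poly_Mapping.single (u @ v @ [y]) c"
  let ?t = "Poly_Mapping.single (v @ y # u) c"
  have 1: "Poly_Mapping.single (y # u @ v) c -
      smul ((-1) ^ (odd_deg [y] * (odd_deg u + odd_deg v))) ?m \<in> relations U"
    using relations.cyclic[OF assms, of y "u @ v"] by simp
  have 2: "?m - smul ((-1) ^ (odd_deg u * (odd_deg v + odd_deg [y]))) ?t \<in> relations U"
    using Cons.IH[of "v @ [y]"] by simp
  show ?case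
    \<comment> \<open>The middle word \<open>?m\<close> cancels in the sum if the first sign is
      plus, and in the difference if it is minus.\<close>
    using relations.add[OF 1 2] relations_diff[OF 1 2]
    by (auto simp: smul_sign odd_deg_Cons[of y u] split: if_splits)
qed

lemma sum_single_lookup:
  "P = (\<Sum>u\<in>Poly_Mapping.keys P. Poly_Mapping.single u (Poly_Mapping.lookup P u))"
  by (rule poly_mapping_eqI) (simp add: lookup_sum lookup_single when_def in_keys_iff)

text \<open>Both products expand over pairs of words; coefficients commute, and each pair is related
  by a rotation. Homogeneity makes the rotation sign the same for all pairs.\<close>

lemma relations_mult_commute:
  fixes P Q :: "('m, 'n::finite) dfun"
  assumes "P \<in> dfuns U" "Q \<in> dfuns U" "homogeneous p P" "homogeneous q Q"
  shows "P * Q - (if even (p * q) then Q * P else - (Q * P)) \<in> relations U"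
proof -
  let ?s = "\<lambda>u v. Poly_Mapping.single (u @ v) (Poly_Mapping.lookup P u * Poly_Mapping.lookup Q v)"
  let ?t = "\<lambda>u v. Poly_Mapping.single (v @ u) (Poly_Mapping.lookup P u * Poly_Mapping.lookup Q v)"
  let ?sg = "\<lambda>F :: ('m, 'n) dfun. if even (p * q) then F else - F"
  have PQ: "P * Q = (\<Sum>u\<in>Poly_Mapping.keys P. \<Sum>v\<in>Poly_Mapping.keys Q. ?s u v)"
    by (subst sum_single_lookup[of P], subst sum_single_lookup[of Q])
      (simp add: sum_product mult_single plus_list_def)
  have "Q * P = (\<Sum>v\<in>Poly_Mapping.keys Q. \<Sum>u\<in>Poly_Mapping.keys P. ?t u v)"
    by (subst sum_single_lookup[of P], subst sum_single_lookup[of Q])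
      (simp add: sum_product mult_single plus_list_def mult.commute)
  also have "\<dots> = (\<Sum>u\<in>Poly_Mapping.keys P. \<Sum>v\<in>Poly_Mapping.keys Q. ?t u v)"
    by (rule sum.swap)
  finally have QP: "Q * P = \<dots>" .
  have "?s u v - ?sg (?t u v) \<in> relations U"
    if "u \<in> Poly_Mapping.keys P" "v \<in> Poly_Mapping.keys Q" for u v
  proof -
    have "smooth U (Poly_Mapping.lookup P u * Poly_Mapping.lookup Q v)"
      using assms(1,2) by (intro smooth_mult dfuns_smooth)
    from relations_rotate[OF this, of u v] show ?thesis
      using assms(3,4) that by (auto simp: homogeneous_def smul_sign split: if_splits)
  qed
  then have "(\<Sum>u\<in>Poly_Mapping.keys P. \<Sum>v\<in>Poly_Mapping.keys Q. ?s u v - ?sg (?t u v))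
      \<in> relations U"
    by (intro relations_sum)
  then show ?thesis
    unfolding PQ QP by (auto simp: sum_subtractf sum.distrib sum_negf)
qed


section \<open>The Schouten bracket\<close>

text \<open>Write A and B for the right derivatives by an even and an odd letter, of degrees k and
  k-1 on \<open>F\<close>. The summands are (-1)^(l-1) A(F)B(G) - B(F)A(G) and (-1)^(k-1) A(G)B(F) -
  B(G)A(F). Commuting each product in the first gives the other term of the second with the common
  factor -(-1)^((k-1)(l-1)).\<close>

lemma schouten_density_skew:
  assumes F: "F \<in> dfuns U" "homogeneous k F" and G: "G \<in> dfuns U" "homogeneous l G"
  shows "schouten_density U F G -
    smul (- ((-1) powi ((k - 1) * (l - 1)))) (schouten_density U G F) \<in> relations U"
proof -
  note rels = relations.add relations_diff relations_uminus
  let ?sg = "\<lambda>X. if even ((k - 1) * (l - 1)) then - X else X"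
  let ?R = "\<lambda>F G j. rvar U (Even_Gen j) F * lvar U (Odd_Gen j) G -
      rvar U (Odd_Gen j) F * lvar U (Even_Gen j) G"
  have even: "lvar U (Even_Gen j) H = rvar U (Even_Gen j) H"
    and odd: "lvar U (Odd_Gen j) H =
      (if even (d - 1) then rvar U (Odd_Gen j) H else - rvar U (Odd_Gen j) H)"
    if "H \<in> dfuns U" "homogeneous d H" for H d j
    \<comment> \<open>The zero multi-index is an arbitrary choice; it only spells out the parity of
      the generator.\<close>
    using lvar_eq_rvar[OF that, of "Even_Gen j" "\<lambda>_. 0"] lvar_eq_rvar[OF that, of "Odd_Gen j" "\<lambda>_. 0"]
    by (simp_all add: odd_deg_def)
  have hom: "homogeneous d (rvar U (Even_Gen j) H)" "homogeneous (d - 1) (rvar U (Odd_Gen j) H)"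
    if "homogeneous d H" for H d j
    using rvar_homogeneous[OF that, of "Even_Gen j" "\<lambda>_. 0" U]
      rvar_homogeneous[OF that, of "Odd_Gen j" "\<lambda>_. 0" U]
    by (simp_all add: odd_deg_def)
  have "?R F G j - ?sg (?R G F j) \<in> relations U" for j
  proof -
    note 1 = relations_mult_commute[OF rvar_dfuns[OF F(1)] rvar_dfuns[OF G(1)]
        hom(1)[OF F(2)] hom(2)[OF G(2)], of j j]
    note 2 = relations_mult_commute[OF rvar_dfuns[OF F(1)] rvar_dfuns[OF G(1)]
        hom(2)[OF F(2)] hom(1)[OF G(2)], of j j]
    show ?thesis
      \<comment> \<open>The goal is (-1)^(l-1) times relation \<open>1\<close> minus relation
        \<open>2\<close>, hence a signed sum or difference of the two; the parities of
        \<open>k\<close> and \<open>l\<close> decide which.\<close>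
      using rels(1)[OF 1 2] rels(2)[OF 1 2] rels(3)[OF rels(1)[OF 1 2]] rels(3)[OF rels(2)[OF 1 2]]
      unfolding even[OF F] even[OF G] odd[OF F] odd[OF G]
      by (cases "even k"; cases "even l") (simp_all add: algebra_simps)
  qed
  then have "(\<Sum>j\<in>UNIV. ?R F G j - ?sg (?R G F j)) \<in> relations U"
    by (intro relations_sum)
  also have "(\<Sum>j\<in>UNIV. ?R F G j - ?sg (?R G F j)) =
      schouten_density U F G - ?sg (schouten_density U G F)"
    unfolding schouten_density_def
    by (cases "even ((k - 1) * (l - 1))") (simp_all only: if_True if_False sum_subtractf sum_negf)
  finally show ?thesis
    by (simp only: smul_neg_powi_sign)
qed

section \<open>From densities to their classes\<close>

lemma vclass_eq_if_related:
  assumes "F - G \<in> relations U"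
  shows "vclass U d F = vclass U d G"
proof -
  have "H - F \<in> relations U \<longleftrightarrow> H - G \<in> relations U" for H
    using relations.add[OF _ assms, of "H - F"] relations_diff[OF _ assms, of "H - G"] by auto
  then show ?thesis
    by (simp add: vclass_def)
qed

lemma class_scale_UN: "class_scale U d r (\<Union>i\<in>I. X i) = (\<Union>i\<in>I. class_scale U d r (X i))"
  by (auto simp: class_scale_def)

text \<open>Scaling by a sign preserves the relations, so all classes in the union coincide. As
  \<open>F\<close> is arbitrary, its class may be empty; the reverse inclusion therefore takes its
  representative from the given element.\<close>

lemma class_scale_vclass:
  fixes F :: "('m, 'n::finite) dfun"
  assumes "r = 1 \<or> r = -1"
  shows "class_scale U d r (vclass U d F) = vclass U d (smul r F)"
proof -
  from assms consider "smul r = (\<lambda>F :: ('m, 'n) dfun. F)" | "smul r = (uminus :: _ \<Rightarrow> ('m, 'n) dfun)"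
    using smul_one smul_minus_one by blast
  then show ?thesis
  proof cases
    case 1
    have "vclass U d H = vclass U d F" if "H \<in> vclass U d F" for H
      using that by (intro vclass_eq_if_related) (simp add: vclass_def)
    moreover have "X \<in> vclass U d X" if "X \<in> vclass U d F" for X
      using that by (simp add: vclass_def relations.zero)
    ultimately show ?thesis
      unfolding class_scale_def 1 by blast
  next
    case 2
    have "vclass U d (- H) = vclass U d (- F)" if "H \<in> vclass U d F" for H
      using that relations_uminus[of "H - F" U]
      by (intro vclass_eq_if_related) (simp add: vclass_def)
    moreover have "- X \<in> vclass U d F" if "X \<in> vclass U d (- F)" for X
      using that relations_uminus[of "X + F" U]
      by (simp add: vclass_def dfuns_uminus homogeneous_uminus)
    ultimately show ?thesis
      unfolding class_scale_def 2 by blast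
  qed
qed

theorem mainTheorem2:
  fixes U :: "(real ^ 'n::{finite,linorder}) set"
    and \<xi> \<eta> :: "('m::finite, 'n) dfun set"
    and k l :: nat
  assumes "open U"
    and "\<xi> \<in> multivectors U (int k)"
    and "\<eta> \<in> multivectors U (int l)"
  shows "schouten U (int k) (int l) \<xi> \<eta> =
    class_scale U (int k + int l - 1) (- ((-1) powi ((int k - 1) * (int l - 1))))
      (schouten U (int l) (int k) \<eta> \<xi>)"
proof -
  let ?d = "int k + int l - 1"
  let ?r = "- ((-1 :: real) powi ((int k - 1) * (int l - 1)))"
  have r: "?r = 1 \<or> ?r = -1"
    by (simp add: power_int_minus_left)
  \<comment> \<open>Skew-symmetry holds for every pair of representatives, so the two unions
    defining the brackets agree term by term once their order is exchanged.\<close>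
  have "vclass U ?d (schouten_density U F G) =
      class_scale U ?d ?r (vclass U ?d (schouten_density U G F))" if "F \<in> \<xi>" "G \<in> \<eta>" for F G
  proof -
    have "F \<in> dfuns U" "homogeneous (int k) F" "G \<in> dfuns U" "homogeneous (int l) G"
      using assms(2,3) that by (auto simp: multivectors_def vclass_def)
    from schouten_density_skew[OF this] show ?thesis
      unfolding class_scale_vclass[OF r] by (rule vclass_eq_if_related)
  qed
  then show ?thesis
    by (simp add: schouten_def add.commute[of "int l"] class_scale_UN SUP_commute[of _ _ \<eta>])
qed

end
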